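(* For all $\ell,k\ge 1$, the generating function $$A_{\ell,k}(x,t)=\sum_{w\in[\ell]^*}x^{k\text{-bond}(w)}t^{|w|}$$ is given by $$A_{\ell,k}(x,t) = 1+(\underbrace{1,\ldots,1}_{\ell})\,\mathbb{A}_{\ell,k}^{-1}\,(\underbrace{-t,\ldots,-t}_{\ell})^{T},$$ where $\mathbb{A}_{\ell,k}$ is the $\ell\times\ell$ matrix whose entries on the main diagonal are all $xt-1$, whose entries on the first $k$ superdiagonals and the first $k$ subdiagonals are all $xt$, and whose remaining entries are all $t$.
   Context: $[\ell]=\{1,\ldots,\ell\}$, $[\ell]^*$ is the set of all finite words over $[\ell]$ (including the empty word), and $|w|$ is the length of $w$. For a word $w=w_1\cdots w_n$, $k\text{-bond}(w)$ is the number of indices $i\in\{1,\ldots,n-1\}$ with $|w_i-w_{i+1}|\le k$. Thus the $(i,j)$ entry of $\mathbb{A}_{\ell,k}$ is $xt-1$ if $i=j$, $xt$ if $1\le|i-j|\le k$, and $t$ if $|i-j|>k$. The identity is one of formal power series in $t$ with coefficients in $\mathbb{Z}[x]$ (at $t=0$ the matrix equals minus the identity, so it is invertible). *)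

theory Defs
  imports
    "HOL-Analysis.Infinite_Sum"
    "HOL-Computational_Algebra.Polynomial"
    "HOL-Computational_Algebra.Formal_Power_Series"
    "Jordan_Normal_Form.Matrix"
begin

text \<open>Power series in \<open>t\<close> over \<open>\<int>[x]\<close> are modelled by the type \<^typ>\<open>int poly fps\<close>.\<close>

abbreviation var_x :: "int poly fps" where
  "var_x \<equiv> fps_const [:0, 1:]"

abbreviation var_t :: "int poly fps" where
  "var_t \<equiv> fps_X"

text \<open>Lists are indexed from 0, so the adjacent positions of \<open>w\<close> are those with \<open>Suc i < length w\<close>.
  The distance is taken in \<open>int\<close> because subtraction on \<open>nat\<close> truncates.\<close>

definition bond :: "nat \<Rightarrow> nat list \<Rightarrow> nat" where
  "bond k w = card {i. Suc i < length w \<and> \<bar>int (w ! i) - int (w ! Suc i)\<bar> \<le> int k}"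

text \<open>The infinite sum is taken in the \<open>t\<close>-adic topology of formal power series. Its value is not the
  default 0 of a non-summable family: there are finitely many words of each length.\<close>

definition bond_gf :: "nat \<Rightarrow> nat \<Rightarrow> int poly fps" where
  "bond_gf l k = (\<Sum>\<^sub>\<infinity>w\<in>lists {1..l}. var_x ^ bond k w * var_t ^ length w)"

text \<open>Rows and columns are indexed by \<open>{0..<l}\<close>; the entries depend only on the distance
  of the indices.\<close>

definition bond_mat :: "nat \<Rightarrow> nat \<Rightarrow> int poly fps mat" where
  "bond_mat l k = mat l l (\<lambda>(i, j).
     if i = j then var_x * var_t - 1
     else if \<bar>int i - int j\<bar> \<le> int k then var_x * var_t
     else var_t)"

text \<open>The inverse over an arbitrary (commutative) ring; \<open>mat_inverse\<close> exists only over fields.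
  It is meaningful only if \<^term>\<open>invertible_mat A\<close>, in which case it is unique.\<close>

definition mat_inv :: "'a :: semiring_1 mat \<Rightarrow> 'a mat" where
  "mat_inv A = (THE B. inverts_mat A B \<and> inverts_mat B A)"

end

theory Submission
  imports Defs
begin

text \<open>
  Put \<open>M\<^bsub>ab\<^esub> = x\<close> if \<open>\<bar>a - b\<bar> \<le> k\<close> and \<open>M\<^bsub>ab\<^esub> = 1\<close> otherwise, so that the matrix of the theorem is
  \<open>t M - I\<close>, with inverse \<open>- (\<Sum>n. t^n M^n)\<close>. Let \<open>F\<^sub>a\<close> be the generating function of the words that
  begin with \<open>a\<close>. Deleting the first letter gives \<open>F\<^sub>a = t + t (\<Sum>b. M\<^bsub>ab\<^esub> F\<^sub>b)\<close>, i.e.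
  \<open>(t M - I) F = (-t, \<dots>, -t)\<close>, and the generating function of all words is \<open>1 + (\<Sum>a. F\<^sub>a)\<close>.
\<close>

text \<open>Distinct series lie at distance \<open>2 ^ - subdegree\<close> of their difference, so
  convergence means that each coefficient is eventually constant. The coefficient at
  \<open>n\<close> is settled once a partial sum covers the finitely many \<open>w\<close> with
  \<open>d w = n\<close>.\<close>

lemma has_sum_fps_monomials:
  fixes c :: "'b \<Rightarrow> 'a :: comm_ring_1" and d :: "'b \<Rightarrow> nat"
  assumes fin: "\<And>n. finite {w \<in> A. d w = n}"
  shows "((\<lambda>w. fps_const (c w) * fps_X ^ d w) has_sum
           Abs_fps (\<lambda>n. \<Sum>w | w \<in> A \<and> d w = n. c w)) A"
  unfolding has_sum_def tendsto_iff
proof (intro allI impI)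
  fix e :: real assume "e > 0"
  let ?G = "Abs_fps (\<lambda>n. \<Sum>w | w \<in> A \<and> d w = n. c w)"
  let ?S = "sum (\<lambda>w. fps_const (c w) * fps_X ^ d w)"
  obtain N where N: "inverse (2 ^ N) < e"
    using real_arch_pow_inv[of e "1/2"] \<open>e > 0\<close> by (auto simp: power_one_over field_simps)
  define Y where "Y = {w \<in> A. d w \<le> N}"
  have "Y = (\<Union>n\<le>N. {w \<in> A. d w = n})"
    by (auto simp: Y_def)
  then have "finite Y" "Y \<subseteq> A"
    using fin by (auto simp: Y_def)
  moreover have "dist (?S X) ?G < e" if X: "finite X" "Y \<subseteq> X" "X \<subseteq> A" for X
  \<comment> \<open>Equality is split off because \<open>subdegree 0 = 0\<close> would break the
    lower bound \<open>N\<close>.\<close>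
  proof (cases "?S X = ?G")
    case False
    have "fps_nth (?S X - ?G) n = 0" if "n \<le> N" for n
    proof -
      have "fps_nth (?S X) n = (\<Sum>w\<in>X. if d w = n then c w else 0)"
        by (auto simp: fps_sum_nth intro!: sum.cong)
      also have "\<dots> = (\<Sum>w | w \<in> X \<and> d w = n. c w)"
        using X by (simp add: sum.inter_filter)
      also have "{w. w \<in> X \<and> d w = n} = {w. w \<in> A \<and> d w = n}"
        using X that by (auto simp: Y_def)
      finally show ?thesis by simp
    qed
    then have "N \<le> subdegree (?S X - ?G)"
      using False by (intro subdegree_geI) auto
    then have "inverse (2 ^ subdegree (?S X - ?G)) \<le> inverse (2 ^ N :: real)"
      by (intro le_imp_inverse_le power_increasing) auto
    also note N
    finally show ?thesis
      using False by (simp add: dist_fps_def)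
  qed (use \<open>e > 0\<close> in simp)
  ultimately show "\<forall>\<^sub>F X in finite_subsets_at_top A. dist (?S X) ?G < e"
    unfolding eventually_finite_subsets_at_top by blast
qed

text \<open>The series \<open>- (\<Sum>n. t^n M^n)\<close> taken entrywise, so that no limit of
  matrices is involved.\<close>

definition fps_resolvent :: "'a :: comm_ring_1 mat \<Rightarrow> 'a fps mat" where
  "fps_resolvent M = mat (dim_row M) (dim_row M) (\<lambda>(i, j). - Abs_fps (\<lambda>n. (M ^\<^sub>m n) $$ (i, j)))"

lemma fps_resolvent_carrier:
  "M \<in> carrier_mat l l \<Longrightarrow> fps_resolvent M \<in> carrier_mat l l"
  by (simp add: fps_resolvent_def)

text \<open>The geometric series telescopes: degree 0 leaves \<open>M^0 = I\<close>, and in each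
  higher degree two copies of a power of \<open>M\<close> cancel. Both products are computed because
  \<open>mat_inv\<close> asks for a two-sided inverse.\<close>

lemma fps_resolvent_inverse:
  fixes M :: "'a :: comm_ring_1 mat"
  assumes M: "M \<in> carrier_mat l l"
  defines "A \<equiv> mat l l (\<lambda>(i, j). fps_X * fps_const (M $$ (i, j)) - (if i = j then 1 else 0))"
  shows "A * fps_resolvent M = 1\<^sub>m l" and "fps_resolvent M * A = 1\<^sub>m l"
proof -
  let ?B = "fps_resolvent M"
  let ?b = "\<lambda>i j. Abs_fps (\<lambda>n. (M ^\<^sub>m n) $$ (i, j))"
  have Mn: "M ^\<^sub>m n \<in> carrier_mat l l" for n
    using M by simp
  \<comment> \<open>Matrix powers unfold with the new factor on the right, whereas
    \<open>A * ?B\<close> produces it on the left.\<close>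
  have comm: "M * M ^\<^sub>m n = M ^\<^sub>m n * M" for n
    using M by (induction n) (auto simp flip: assoc_mult_mat[OF M Mn M])
  \<comment> \<open>The fresh type \<open>'r\<close> allows use both over \<open>'a\<close> (powers
    of \<open>M\<close>) and over \<open>'a fps\<close>.\<close>
  have mult_nth: "(P * Q) $$ (i, j) = (\<Sum>h<l. P $$ (i, h) * Q $$ (h, j))"
    if "P \<in> carrier_mat l l" "Q \<in> carrier_mat l l" "i < l" "j < l"
    for P Q :: "'r :: comm_ring_1 mat" and i j
    using that by (auto simp: scalar_prod_def atLeast0LessThan)
  have delta: "(\<Sum>h<l. (if i = h then 1 else 0) * f h) = f i"
    "(\<Sum>h<l. f h * (if h = i then 1 else 0)) = f i" if "i < l" for i and f :: "nat \<Rightarrow> 'a fps"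
    using that by (auto simp: if_distrib[of "\<lambda>z. z * _"] if_distrib[of "\<lambda>z. _ * z"] cong: if_cong)
  have A: "A \<in> carrier_mat l l" and B: "?B \<in> carrier_mat l l"
    using M by (auto simp: A_def fps_resolvent_def)
  show "A * ?B = 1\<^sub>m l"
  proof (rule eq_matI)
    fix i j assume "i < dim_row (1\<^sub>m l)" "j < dim_col (1\<^sub>m l)"
    then have ij: "i < l" "j < l" by auto
    have "(A * ?B) $$ (i, j) =
        (\<Sum>h<l. (fps_X * fps_const (M $$ (i, h)) - (if i = h then 1 else 0)) * - ?b h j)"
      unfolding mult_nth[OF A B ij] using ij M
      by (intro sum.cong) (auto simp: A_def fps_resolvent_def)
    also have "\<dots> = ?b i j - fps_X * (\<Sum>h<l. fps_const (M $$ (i, h)) * ?b h j)"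
      using ij by (simp add: left_diff_distrib sum_subtractf sum_negf delta sum_distrib_left mult.assoc)
    also have "\<dots> = 1\<^sub>m l $$ (i, j)"
    proof (rule fps_ext)
      fix n
      have "(M ^\<^sub>m Suc m) $$ (i, j) = (\<Sum>h<l. M $$ (i, h) * (M ^\<^sub>m m) $$ (h, j))" for m
        using mult_nth[OF M Mn ij] comm by simp
      then show "fps_nth (?b i j - fps_X * (\<Sum>h<l. fps_const (M $$ (i, h)) * ?b h j)) n =
          fps_nth (1\<^sub>m l $$ (i, j)) n"
        using ij M by (cases n) (auto simp: fps_sum_nth)
    qed
    finally show "(A * ?B) $$ (i, j) = 1\<^sub>m l $$ (i, j)" .
  qed (use A B in auto)
  show "?B * A = 1\<^sub>m l"
  proof (rule eq_matI)
    fix i j assume "i < dim_row (1\<^sub>m l)" "j < dim_col (1\<^sub>m l)"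
    then have ij: "i < l" "j < l" by auto
    have "(?B * A) $$ (i, j) =
        (\<Sum>h<l. - ?b i h * (fps_X * fps_const (M $$ (h, j)) - (if h = j then 1 else 0)))"
      unfolding mult_nth[OF B A ij] using ij M
      by (intro sum.cong) (auto simp: A_def fps_resolvent_def)
    also have "\<dots> = ?b i j - fps_X * (\<Sum>h<l. ?b i h * fps_const (M $$ (h, j)))"
      using ij by (simp add: right_diff_distrib sum_subtractf sum_negf delta sum_distrib_left
          mult.left_commute[of _ fps_X])
    also have "\<dots> = 1\<^sub>m l $$ (i, j)"
    proof (rule fps_ext)
      fix n
      have "(M ^\<^sub>m Suc m) $$ (i, j) = (\<Sum>h<l. (M ^\<^sub>m m) $$ (i, h) * M $$ (h, j))" for m
        using mult_nth[OF Mn M ij] by simp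
      then show "fps_nth (?b i j - fps_X * (\<Sum>h<l. ?b i h * fps_const (M $$ (h, j)))) n =
          fps_nth (1\<^sub>m l $$ (i, j)) n"
        using ij M by (cases n) (auto simp: fps_sum_nth)
    qed
    finally show "(?B * A) $$ (i, j) = 1\<^sub>m l $$ (i, j)" .
  qed (use A B in auto)
qed

lemma mat_inv_eqI:
  assumes "A \<in> carrier_mat n n" "B \<in> carrier_mat n n" "A * B = 1\<^sub>m n" "B * A = 1\<^sub>m n"
  shows "mat_inv A = B"
  unfolding mat_inv_def
proof (rule the_equality)
  show "inverts_mat A B \<and> inverts_mat B A"
    using assms by (auto simp: inverts_mat_def)
next
  fix C assume C: "inverts_mat A C \<and> inverts_mat C A"
  then have AC: "A * C = 1\<^sub>m n" and CA: "C * A = 1\<^sub>m (dim_row C)"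
    using assms by (auto simp: inverts_mat_def)
  \<comment> \<open>\<open>inverts_mat\<close> does not fix the shape of \<open>C\<close>; comparing
    column counts in both equations does.\<close>
  have "dim_col C = n" "dim_row C = n"
    using arg_cong[OF AC, of dim_col] arg_cong[OF CA, of dim_col] assms by auto
  then have car: "C \<in> carrier_mat n n" by auto
  have "C = (B * A) * C" using assms car by simp
  also have "\<dots> = B * (A * C)" using assms car by (intro assoc_mult_mat) auto
  also have "\<dots> = B" using assms AC by simp
  finally show "C = B" .
qed

definition bond_weight :: "nat \<Rightarrow> nat \<Rightarrow> nat \<Rightarrow> int poly" where
  "bond_weight k a b = (if \<bar>int a - int b\<bar> \<le> int k then [:0, 1:] else 1)"

lemma bond_Nil [simp]: "bond k [] = 0" and bond_single [simp]: "bond k [a] = 0"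
  by (auto simp: bond_def)

text \<open>Position 0 tests the pair \<open>a\<close>, \<open>b\<close>; the positions of
  \<open>b # w\<close> reappear shifted by \<open>Suc\<close>, hence disjoint from 0.\<close>

lemma bond_Cons_Cons:
  "bond k (a # b # w) = (if \<bar>int a - int b\<bar> \<le> int k then 1 else 0) + bond k (b # w)"
proof -
  let ?S = "\<lambda>w. {i. Suc i < length w \<and> \<bar>int (w ! i) - int (w ! Suc i)\<bar> \<le> int k}"
  let ?Z = "if \<bar>int a - int b\<bar> \<le> int k then {0::nat} else {}"
  have "?S (a # b # w) = ?Z \<union> Suc ` ?S (b # w)"
  proof (rule Set.set_eqI)
    show "i \<in> ?S (a # b # w) \<longleftrightarrow> i \<in> ?Z \<union> Suc ` ?S (b # w)" for i
      by (cases i) auto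
  qed
  moreover have "finite (?S (b # w))"
    by (rule finite_subset[of _ "{..<length (b # w)}"]) auto
  ultimately show ?thesis
    unfolding bond_def by (auto simp: card_image card_insert_if)
qed

definition words :: "nat \<Rightarrow> nat \<Rightarrow> nat list set" where
  "words l n = {w. set w \<subseteq> {1..l} \<and> length w = n}"

text \<open>The coefficient of \<open>t^(n+1)\<close> in \<open>F_a\<close>: \<open>n\<close> counts
  only the letters after \<open>a\<close>.\<close>

definition ext_poly :: "nat \<Rightarrow> nat \<Rightarrow> nat \<Rightarrow> nat \<Rightarrow> int poly" where
  "ext_poly l k n a = (\<Sum>w\<in>words l n. [:0, 1:] ^ bond k (a # w))"

lemma words_0 [simp]: "words l 0 = {[]}"
  by (auto simp: words_def)

lemma finite_words: "finite (words l n)"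
  by (simp add: words_def finite_lists_length_eq)

text \<open>Splits off the first letter. Letters start at 1 and matrix indices at 0, so index
  \<open>i\<close> stands for the letter \<open>Suc i\<close>.\<close>

lemma sum_words_Suc: "(\<Sum>w\<in>words l (Suc n). f w) = (\<Sum>i<l. \<Sum>w\<in>words l n. f (Suc i # w))"
proof -
  have "(\<Sum>w\<in>words l (Suc n). f w) = (\<Sum>(w, a)\<in>words l n \<times> {1..l}. f (a # w))"
    unfolding words_def lists_length_Suc_eq
    by (subst sum.reindex) (auto simp: inj_on_def case_prod_unfold)
  also have "\<dots> = (\<Sum>a=1..l. \<Sum>w\<in>words l n. f (a # w))"
    by (subst sum.cartesian_product[symmetric]) (rule sum.swap)
  also have "\<dots> = (\<Sum>i<l. \<Sum>w\<in>words l n. f (Suc i # w))"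
    by (rule sum.reindex_bij_witness[of _ Suc "\<lambda>a. a - 1"]) auto
  finally show ?thesis .
qed

lemma ext_poly_0: "ext_poly l k 0 a = 1"
  by (simp add: ext_poly_def)

text \<open>The transfer matrix step: the letter after \<open>a\<close> contributes its weight and
  then acts as the new first letter.\<close>

lemma ext_poly_Suc:
  "ext_poly l k (Suc n) a = (\<Sum>i<l. bond_weight k a (Suc i) * ext_poly l k n (Suc i))"
  unfolding ext_poly_def sum_words_Suc sum_distrib_left
  by (intro sum.cong refl) (simp add: bond_Cons_Cons bond_weight_def)

definition first_letter_gf :: "nat \<Rightarrow> nat \<Rightarrow> nat \<Rightarrow> int poly fps" where
  "first_letter_gf l k a = fps_X * Abs_fps (\<lambda>n. ext_poly l k n a)"

text \<open>The 1 is the empty word; all other words are sorted by first letter. Grouping by length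
  into finite classes evaluates the infinite sum.\<close>

lemma bond_gf_eq: "bond_gf l k = 1 + (\<Sum>i<l. first_letter_gf l k (Suc i))"
proof -
  have eq: "{w \<in> lists {1..l}. length w = n} = words l n" for n
    by (auto simp: words_def)
  have "((\<lambda>w. fps_const ([:0, 1:] ^ bond k w) * fps_X ^ length w) has_sum
      Abs_fps (\<lambda>n. \<Sum>w\<in>words l n. [:0, 1:] ^ bond k w :: int poly)) (lists {1..l})"
    using has_sum_fps_monomials[of "lists {1..l}" length "\<lambda>w. [:0, 1:] ^ bond k w :: int poly"]
    by (simp only: eq finite_words)
  then have "bond_gf l k = Abs_fps (\<lambda>n. \<Sum>w\<in>words l n. [:0, 1:] ^ bond k w)"
    unfolding bond_gf_def by (simp only: fps_const_power infsumI)
  also have "\<dots> = 1 + (\<Sum>i<l. first_letter_gf l k (Suc i))"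
  proof (rule fps_ext)
    show "fps_nth (Abs_fps (\<lambda>n. \<Sum>w\<in>words l n. [:0, 1:] ^ bond k w)) n =
        fps_nth (1 + (\<Sum>i<l. first_letter_gf l k (Suc i))) n" for n
      by (cases n) (auto simp: fps_sum_nth first_letter_gf_def sum_words_Suc ext_poly_def)
  qed
  finally show ?thesis .
qed

text \<open>The summand \<open>fps_X\<close> is the one-letter word; from a longer word the first
  letter is deleted.\<close>

lemma first_letter_gf_rec:
  "first_letter_gf l k a =
     fps_X + fps_X * (\<Sum>i<l. fps_const (bond_weight k a (Suc i)) * first_letter_gf l k (Suc i))"
proof (rule fps_ext)
  show "fps_nth (first_letter_gf l k a) n = fps_nth (fps_X +
      fps_X * (\<Sum>i<l. fps_const (bond_weight k a (Suc i)) * first_letter_gf l k (Suc i))) n" for n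
  proof (cases n)
    case (Suc m)
    then show ?thesis
      \<comment> \<open>In degree 1 (\<open>m = 0\<close>) the sum vanishes, as every
        \<open>first_letter_gf\<close> has constant term 0.\<close>
      by (cases m) (auto simp: first_letter_gf_def fps_sum_nth ext_poly_0 ext_poly_Suc)
  qed (simp add: first_letter_gf_def)
qed

definition weight_mat :: "nat \<Rightarrow> nat \<Rightarrow> int poly mat" where
  "weight_mat l k = mat l l (\<lambda>(i, j). bond_weight k (Suc i) (Suc j))"

text \<open>The shift by \<open>Suc\<close> preserves distances, and distance 0 has weight
  \<open>x\<close>, which yields the diagonal \<open>x t - 1\<close>.\<close>

lemma bond_mat_eq:
  "bond_mat l k =
     mat l l (\<lambda>(i, j). fps_X * fps_const (weight_mat l k $$ (i, j)) - (if i = j then 1 else 0))"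
  by (rule eq_matI) (auto simp: bond_mat_def weight_mat_def bond_weight_def mult.commute)

lemma bond_mat_mult_first_letter_gf:
  "bond_mat l k *\<^sub>v vec l (\<lambda>i. first_letter_gf l k (Suc i)) = vec l (\<lambda>_. - fps_X)"
proof (rule eq_vecI)
  fix i assume "i < dim_vec (vec l (\<lambda>_. - fps_X :: int poly fps))"
  then have i: "i < l" by simp
  let ?F = "\<lambda>i. first_letter_gf l k (Suc i)"
  have "(bond_mat l k *\<^sub>v vec l ?F) $ i =
      (\<Sum>j<l. (fps_X * fps_const (bond_weight k (Suc i) (Suc j)) - (if i = j then 1 else 0)) * ?F j)"
    using i by (auto simp: bond_mat_eq weight_mat_def scalar_prod_def atLeast0LessThan intro!: sum.cong)
  also have "\<dots> = fps_X * (\<Sum>j<l. fps_const (bond_weight k (Suc i) (Suc j)) * ?F j) - ?F i"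
    using i by (simp add: left_diff_distrib sum_subtractf sum_distrib_left mult.assoc
        if_distrib[of "\<lambda>z. z * _"] cong: if_cong)
  also have "\<dots> = - fps_X"
    \<comment> \<open>Only the isolated \<open>?F i\<close> is unfolded; its sum cancels the one
      already present.\<close>
    by (subst (2) first_letter_gf_rec) simp
  finally show "(bond_mat l k *\<^sub>v vec l ?F) $ i = vec l (\<lambda>_. - fps_X) $ i"
    using i by simp
qed (simp add: bond_mat_def)

theorem theorem6:
  fixes l k :: nat
  assumes "l \<ge> 1" and "k \<ge> 1"
  shows "invertible_mat (bond_mat l k) \<and>
    bond_gf l k = 1 + vec l (\<lambda>_. 1) \<bullet> (mat_inv (bond_mat l k) *\<^sub>v vec l (\<lambda>_. - var_t))"
proof -
  let ?A = "bond_mat l k" and ?B = "fps_resolvent (weight_mat l k)"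
  let ?F = "vec l (\<lambda>i. first_letter_gf l k (Suc i))"
  have W: "weight_mat l k \<in> carrier_mat l l"
    by (simp add: weight_mat_def)
  have A: "?A \<in> carrier_mat l l" and B: "?B \<in> carrier_mat l l"
    using fps_resolvent_carrier[OF W] by (auto simp: bond_mat_def)
  have AB: "?A * ?B = 1\<^sub>m l" and BA: "?B * ?A = 1\<^sub>m l"
    unfolding bond_mat_eq by (rule fps_resolvent_inverse[OF W])+
  have "invertible_mat ?A"
    unfolding invertible_mat_def inverts_mat_def using A B AB BA by auto
  \<comment> \<open>Writing the right-hand side as \<open>?A *\<^sub>v ?F\<close> lets the inverse
    cancel, leaving \<open>?F\<close>.\<close>
  moreover have "mat_inv ?A *\<^sub>v vec l (\<lambda>_. - var_t) = ?B *\<^sub>v (?A *\<^sub>v ?F)"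
    unfolding mat_inv_eqI[OF A B AB BA] bond_mat_mult_first_letter_gf ..
  moreover have "\<dots> = ?F"
    using assoc_mult_mat_vec[OF B A, of ?F] BA by simp
  moreover have "vec l (\<lambda>_. 1) \<bullet> ?F = (\<Sum>i<l. first_letter_gf l k (Suc i))"
    by (simp add: scalar_prod_def atLeast0LessThan)
  ultimately show ?thesis
    by (simp add: bond_gf_eq)
qed

end
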